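(* A language $L\subseteq A^*$ satisfies the families of ultrafilter equations $\mathcal E_{ab=ba}$, $\mathcal E_{aab=abb}$ and $\mathcal E_{a=a.a}$ for every $a,b\in A$ if and only if there exists a finite colouring $(Q_1,\dots,Q_\ell)$ of $\mathbb N$, for some $\ell\geq1$, such that for every $a,b\in A$: $\bigcup_{i=1}^\ell A^*\otimes Q_i^2\subseteq E_{L,f_{a,b},f_{b,a}}$, $\bigcup_{i=1}^\ell A^*\otimes Q_i^3\subseteq E_{L,f_{a,a,b},f_{a,b,b}}$, and $\bigcup_{i=1}^\ell L_{Q_i}\otimes Q_i\subseteq E_{L,f_a,f_a.a}$, where $L_{Q_i}\otimes Q_i:=\{(w,j)\in A^*\otimes\mathbb N: j\in Q_i \text{ and } |w|\in Q_i\}$.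
   Context: $A$ is a finite alphabet. $A^*\otimes\mathbb N^n:=\{(w,j_1,\dots,j_n): w\in A^*, j_m<|w|\ \forall m\}$, and $A^*\otimes Q^n$ is its subset with all $j_m\in Q$. $\beta(S)$ is the set of ultrafilters on $S$, $\beta f(\nu):=\{P: f^{-1}(P)\in\nu\}$. $L$ satisfies $\gamma_1\leftrightarrow\gamma_2$ iff ($L\in\gamma_1\iff L\in\gamma_2$). For $p_1,\dots,p_n:D\to\mathbb N$ and $u,v:D\to A^*$ with $D=A^*\otimes\mathbb N^n$, $\mathcal E^{p_1,\dots,p_n}_{u=v}$ is the family of equations $\beta u(\nu)\leftrightarrow\beta v(\nu)$, $\nu\in\beta(D)$ with $\beta p_1(\nu)=\dots=\beta p_n(\nu)$; and $E_{L,u,v}:=\{x\in D: u(x)\in L\iff v(x)\in L\}$. $w((j_1,\dots,j_m)\to(b_1,\dots,b_m))$ replaces the letter at position $j_r$ by $b_r$. $f_{a,b}(w,j_1,j_2):=w((j_1,j_2)\to(a,b))$ if $j_1\neq j_2$, else $w$; $f_{a,a,b}(w,j_1,j_2,j_3):=w((j_1,j_2,j_3)\to(a,a,b))$ if $j_1,j_2,j_3$ pairwise distinct, else $w$ (similarly $f_{a,b,b}$); $f_a(w,i):=w(i\to a)$, $(f_a.a)(w,i):=w(i\to a)\,a$. With $\pi_r$ the coordinate projections, $\pi(w,i)=i$, $|\cdot|(w,i)=|w|$: $\mathcal E_{ab=ba}:=\mathcal E^{\pi_1,\pi_2}_{f_{a,b}=f_{b,a}}$, $\mathcal E_{aab=abb}:=\mathcal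 E^{\pi_1,\pi_2,\pi_3}_{f_{a,a,b}=f_{a,b,b}}$, $\mathcal E_{a=a.a}:=\mathcal E^{\pi,|\cdot|}_{f_a=f_a.a}$. *)

theory Defs
  imports "HOL-Library.Disjoint_Sets"
begin

section \<open>Ultrafilters and ultrafilter equations\<close>

definition ultrafilters_on :: "'s set \<Rightarrow> 's set set set" where
  "ultrafilters_on S =
    {\<nu>. \<nu> \<subseteq> Pow S \<and> S \<in> \<nu> \<and> {} \<notin> \<nu> \<and>
      (\<forall>X Y. X \<in> \<nu> \<longrightarrow> X \<subseteq> Y \<longrightarrow> Y \<subseteq> S \<longrightarrow> Y \<in> \<nu>) \<and>
      (\<forall>X Y. X \<in> \<nu> \<longrightarrow> Y \<in> \<nu> \<longrightarrow> X \<inter> Y \<in> \<nu>) \<and>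
      (\<forall>X. X \<subseteq> S \<longrightarrow> X \<in> \<nu> \<or> S - X \<in> \<nu>)}"

text \<open>The extension \<open>\<beta>f\<close> of a map \<open>f\<close> from \<open>S\<close> to \<open>T\<close>.\<close>

definition beta_map :: "'s set \<Rightarrow> 't set \<Rightarrow> ('s \<Rightarrow> 't) \<Rightarrow> 's set set \<Rightarrow> 't set set" where
  "beta_map S T f \<nu> = {P. P \<subseteq> T \<and> {x \<in> S. f x \<in> P} \<in> \<nu>}"

text \<open>An equation \<open>\<gamma>\<^sub>1 \<leftrightarrow> \<gamma>\<^sub>2\<close> is the pair \<open>(\<gamma>\<^sub>1, \<gamma>\<^sub>2)\<close>, and a family of equations is a set of pairs.\<close>

definition satisfies_eq :: "'s set \<Rightarrow> 's set set \<times> 's set set \<Rightarrow> bool" where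
  "satisfies_eq L e \<longleftrightarrow> (L \<in> fst e \<longleftrightarrow> L \<in> snd e)"

definition satisfies_family :: "'s set \<Rightarrow> ('s set set \<times> 's set set) set \<Rightarrow> bool" where
  "satisfies_family L \<E> \<longleftrightarrow> (\<forall>e\<in>\<E>. satisfies_eq L e)"


section \<open>Words with marked positions\<close>

text \<open>
  The element \<open>(w, j\<^sub>1, \<dots>, j\<^sub>n)\<close> is represented by \<open>(w, [j\<^sub>1, \<dots>, j\<^sub>n])\<close>, so that all arities \<open>n\<close>
  share one type. Positions in a word are counted from \<open>0\<close>.
  \<open>tensor A n Q\<close> is \<open>A\<^sup>* \<otimes> Q\<^sup>n\<close>, and \<open>A\<^sup>* \<otimes> \<nat>\<^sup>n\<close> is the case \<open>Q = UNIV\<close>.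
\<close>

type_synonym 'a marked_word = "'a list \<times> nat list"

definition tensor :: "'a set \<Rightarrow> nat \<Rightarrow> nat set \<Rightarrow> 'a marked_word set" where
  "tensor A n Q =
    {(w, js). w \<in> lists A \<and> length js = n \<and> (\<forall>j\<in>set js. j < length w \<and> j \<in> Q)}"

text \<open>\<open>len_tensor A Q\<close> is \<open>L\<^sub>Q \<otimes> Q\<close>, where also the length of the word lies in \<open>Q\<close>.\<close>

definition len_tensor :: "'a set \<Rightarrow> nat set \<Rightarrow> 'a marked_word set" where
  "len_tensor A Q = {(w, js) \<in> tensor A 1 UNIV. js ! 0 \<in> Q \<and> length w \<in> Q}"

text \<open>\<open>proj r\<close> is the coordinate projection \<open>\<pi>\<^sub>r\<close>, for \<open>r \<ge> 1\<close>.\<close>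

definition proj :: "nat \<Rightarrow> 'a marked_word \<Rightarrow> nat" where
  "proj r x = snd x ! (r - 1)"

definition word_len :: "'a marked_word \<Rightarrow> nat" where
  "word_len x = length (fst x)"

definition replace_at :: "'a list \<Rightarrow> nat list \<Rightarrow> 'a list \<Rightarrow> 'a list" where
  "replace_at w js bs = fold (\<lambda>(j, b) w'. w'[j := b]) (zip js bs) w"

text \<open>
  \<open>subst_letters [b\<^sub>1, \<dots>, b\<^sub>n]\<close> is the map \<open>f\<close> with index \<open>b\<^sub>1, \<dots>, b\<^sub>n\<close>; for \<open>n = 1\<close> the
  distinctness condition is void.
\<close>

definition subst_letters :: "'a list \<Rightarrow> 'a marked_word \<Rightarrow> 'a list" where
  "subst_letters bs = (\<lambda>(w, js). if distinct js then replace_at w js bs else w)"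

text \<open>The map \<open>f\<^sub>a.a\<close>.\<close>

definition subst_append :: "'a \<Rightarrow> 'a marked_word \<Rightarrow> 'a list" where
  "subst_append a x = subst_letters [a] x @ [a]"

definition eq_family ::
  "'a set \<Rightarrow> nat \<Rightarrow> ('a marked_word \<Rightarrow> nat) list \<Rightarrow>
   ('a marked_word \<Rightarrow> 'a list) \<Rightarrow> ('a marked_word \<Rightarrow> 'a list) \<Rightarrow>
   ('a list set set \<times> 'a list set set) set" where
  "eq_family A n ps u v =
    (let D = tensor A n UNIV in
      {(beta_map D (lists A) u \<nu>, beta_map D (lists A) v \<nu>) | \<nu>.
         \<nu> \<in> ultrafilters_on D \<and>
         (\<forall>p\<in>set ps. \<forall>q\<in>set ps. beta_map D UNIV p \<nu> = beta_map D UNIV q \<nu>)})"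

definition E_set ::
  "'a set \<Rightarrow> nat \<Rightarrow> 'a list set \<Rightarrow> ('a marked_word \<Rightarrow> 'a list) \<Rightarrow>
   ('a marked_word \<Rightarrow> 'a list) \<Rightarrow> 'a marked_word set" where
  "E_set A n L u v = {x \<in> tensor A n UNIV. u x \<in> L \<longleftrightarrow> v x \<in> L}"

definition Eq_ab_ba :: "'a set \<Rightarrow> 'a \<Rightarrow> 'a \<Rightarrow> ('a list set set \<times> 'a list set set) set" where
  "Eq_ab_ba A a b =
    eq_family A 2 [proj 1, proj 2] (subst_letters [a, b]) (subst_letters [b, a])"

definition Eq_aab_abb :: "'a set \<Rightarrow> 'a \<Rightarrow> 'a \<Rightarrow> ('a list set set \<times> 'a list set set) set" where
  "Eq_aab_abb A a b =
    eq_family A 3 [proj 1, proj 2, proj 3] (subst_letters [a, a, b]) (subst_letters [a, b, b])"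

definition Eq_a_aa :: "'a set \<Rightarrow> 'a \<Rightarrow> ('a list set set \<times> 'a list set set) set" where
  "Eq_a_aa A a = eq_family A 1 [proj 1, word_len] (subst_letters [a]) (subst_append a)"


section \<open>Finite colourings\<close>

text \<open>Colour classes are allowed to be empty.\<close>

definition finite_colouring :: "nat \<Rightarrow> (nat \<Rightarrow> nat set) \<Rightarrow> bool" where
  "finite_colouring l Q \<longleftrightarrow> disjoint_family_on Q {1..l} \<and> (\<Union>i\<in>{1..l}. Q i) = UNIV"

end

theory Submission
  imports Defs
begin

text \<open>
  Every equation family is characterised by compactness: \<open>L\<close> satisfies \<open>\<E>\<^sub>u\<^sub>=\<^sub>v\<close> iff finitely many sets
  \<open>P \<subseteq> \<nat>\<close> suffice such that \<open>u x \<in> L \<longleftrightarrow> v x \<in> L\<close> whenever no such \<open>P\<close> separates the values \<open>p\<^sub>i x\<close>.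
  If no finite family suffices, the sets of counterexamples have the finite intersection property,
  and an ultrafilter containing all of them equalises the \<open>p\<^sub>i\<close> but violates the equation.
  Since the alphabet is finite, the finite families for all letters can be united; the cells of the
  partition that the union generates are the colour classes.
\<close>

section \<open>Ultrafilters: Boolean operations and extension of set families\<close>

lemma ultrafilters_onD:
  assumes "\<nu> \<in> ultrafilters_on S"
  shows "S \<in> \<nu>" "{} \<notin> \<nu>"
    and "\<And>X Y. X \<in> \<nu> \<Longrightarrow> X \<subseteq> Y \<Longrightarrow> Y \<subseteq> S \<Longrightarrow> Y \<in> \<nu>"
    and "\<And>X Y. X \<in> \<nu> \<Longrightarrow> Y \<in> \<nu> \<Longrightarrow> X \<inter> Y \<in> \<nu>"
    and "\<And>X. X \<subseteq> S \<Longrightarrow> X \<in> \<nu> \<or> S - X \<in> \<nu>"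
  using assms unfolding ultrafilters_on_def mem_Collect_eq by metis+

lemma ultrafilter_conj_iff:
  assumes "\<nu> \<in> ultrafilters_on S"
  shows "{x \<in> S. P x \<and> Q x} \<in> \<nu> \<longleftrightarrow> {x \<in> S. P x} \<in> \<nu> \<and> {x \<in> S. Q x} \<in> \<nu>"
proof
  assume "{x \<in> S. P x \<and> Q x} \<in> \<nu>"
  then show "{x \<in> S. P x} \<in> \<nu> \<and> {x \<in> S. Q x} \<in> \<nu>"
    by (intro conjI; elim ultrafilters_onD(3)[OF assms]) blast+
next
  assume "{x \<in> S. P x} \<in> \<nu> \<and> {x \<in> S. Q x} \<in> \<nu>"
  then have "{x \<in> S. P x} \<inter> {x \<in> S. Q x} \<in> \<nu>"
    using ultrafilters_onD(4)[OF assms] by blast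
  moreover have "{x \<in> S. P x} \<inter> {x \<in> S. Q x} = {x \<in> S. P x \<and> Q x}"
    by blast
  ultimately show "{x \<in> S. P x \<and> Q x} \<in> \<nu>"
    by simp
qed

lemma ultrafilter_not_iff:
  assumes "\<nu> \<in> ultrafilters_on S"
  shows "{x \<in> S. \<not> P x} \<in> \<nu> \<longleftrightarrow> {x \<in> S. P x} \<notin> \<nu>"
proof -
  have "{x \<in> S. P x} \<in> \<nu> \<or> S - {x \<in> S. P x} \<in> \<nu>"
    by (rule ultrafilters_onD(5)[OF assms]) blast
  moreover have "S - {x \<in> S. P x} = {x \<in> S. \<not> P x}"
    by blast
  moreover have "\<not> ({x \<in> S. P x} \<in> \<nu> \<and> {x \<in> S. \<not> P x} \<in> \<nu>)"
    using ultrafilter_conj_iff[OF assms, of P "\<lambda>x. \<not> P x"] ultrafilters_onD(2)[OF assms] by simp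
  ultimately show ?thesis
    by auto
qed

text \<open>Membership in an ultrafilter commutes with conjunction and negation, hence with
  equivalence. This turns an equality of two images under \<open>beta_map\<close> into membership of
  agreement sets in \<nu> itself.\<close>

lemma ultrafilter_iff_iff:
  assumes "\<nu> \<in> ultrafilters_on S"
  shows "{x \<in> S. P x \<longleftrightarrow> Q x} \<in> \<nu> \<longleftrightarrow> ({x \<in> S. P x} \<in> \<nu> \<longleftrightarrow> {x \<in> S. Q x} \<in> \<nu>)"
proof -
  have eq: "{x \<in> S. P x \<longleftrightarrow> Q x} = {x \<in> S. \<not> (P x \<and> \<not> Q x) \<and> \<not> (\<not> P x \<and> Q x)}"
    by blast
  show ?thesis
    unfolding eq ultrafilter_conj_iff[OF assms] ultrafilter_not_iff[OF assms] by blast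
qed

lemma ultrafilter_ball_finite:
  assumes "\<nu> \<in> ultrafilters_on S" "finite I" "\<And>i. i \<in> I \<Longrightarrow> {x \<in> S. P i x} \<in> \<nu>"
  shows "{x \<in> S. \<forall>i\<in>I. P i x} \<in> \<nu>"
  using assms(2,3)
proof (induction I)
  case empty
  then show ?case using ultrafilters_onD(1)[OF assms(1)] by simp
next
  case (insert i I)
  then show ?case by (simp add: ultrafilter_conj_iff[OF assms(1)])
qed

text \<open>Zorn's lemma gives a maximal family among those that contain \<open>B\<close> and have
  the finite intersection property; maximality forces it to be an ultrafilter. Intersecting with
  \<open>S\<close> gives the empty subfamily the intersection \<open>S\<close> instead of
  \<open>UNIV\<close>.\<close>

lemma ultrafilter_extends_fip:
  assumes "B \<subseteq> Pow S" and fip: "\<And>F. finite F \<Longrightarrow> F \<subseteq> B \<Longrightarrow> S \<inter> \<Inter>F \<noteq> {}"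
  obtains \<nu> where "\<nu> \<in> ultrafilters_on S" "B \<subseteq> \<nu>"
proof -
  define \<F> where
    "\<F> = {G. B \<subseteq> G \<and> G \<subseteq> Pow S \<and> (\<forall>F. finite F \<longrightarrow> F \<subseteq> G \<longrightarrow> S \<inter> \<Inter>F \<noteq> {})}"
  have \<F>D: "B \<subseteq> G" "G \<subseteq> Pow S" "\<And>F. finite F \<Longrightarrow> F \<subseteq> G \<Longrightarrow> S \<inter> \<Inter>F \<noteq> {}"
    if "G \<in> \<F>" for G
    using that unfolding \<F>_def by simp_all
  have \<F>I: "G \<in> \<F>"
    if "B \<subseteq> G" "G \<subseteq> Pow S" "\<And>F. finite F \<Longrightarrow> F \<subseteq> G \<Longrightarrow> S \<inter> \<Inter>F \<noteq> {}" for G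
    using that unfolding \<F>_def by simp
  have "B \<in> \<F>"
    by (rule \<F>I[OF order.refl assms])
  have "\<Union>C \<in> \<F>" if C: "C \<noteq> {}" "subset.chain \<F> C" for C
  proof (rule \<F>I)
    have mem: "G \<in> \<F>" if "G \<in> C" for G
      using C(2) that unfolding subset.chain_def by (elim conjE) (rule subsetD)
    show "B \<subseteq> \<Union>C"
      using C(1) mem[THEN \<F>D(1)] by fastforce
    show "\<Union>C \<subseteq> Pow S"
      using mem[THEN \<F>D(2)] by (rule Union_least)
    fix F
    assume F: "finite F" "F \<subseteq> \<Union>C"
    \<comment> \<open>The finite intersection property involves only finitely many sets at a time,
      and in a nonempty chain these already lie in a single member.\<close>
    obtain G where "G \<in> C" "F \<subseteq> G"
      by (rule finite_subset_Union_chain[OF F C])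
    then show "S \<inter> \<Inter>F \<noteq> {}"
      using \<F>D(3)[OF mem F(1)] by simp
  qed
  then have "\<exists>M\<in>\<F>. \<forall>X\<in>\<F>. M \<subseteq> X \<longrightarrow> X = M"
    using \<open>B \<in> \<F>\<close> by (intro subset_Zorn_nonempty) auto
  then obtain M where M: "M \<in> \<F>" and max: "\<And>X. X \<in> \<F> \<Longrightarrow> M \<subseteq> X \<Longrightarrow> X = M"
    by metis
  note BM = \<F>D(1,2)[OF M] and fipM = \<F>D(3)[OF M]
  \<comment> \<open>By maximality, adding \<open>X\<close> destroys the finite intersection
    property. Removing \<open>X\<close> from the finite family that shows this leaves a part of
    \<open>M\<close> whose intersection misses \<open>X\<close>.\<close>
  have avoid: "\<exists>F. finite F \<and> F \<subseteq> M \<and> S \<inter> \<Inter>F \<inter> X = {}" if X: "X \<subseteq> S" "X \<notin> M" for X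
  proof -
    have "insert X M \<notin> \<F>"
      using max[of "insert X M"] X(2) by blast
    then have "\<exists>F. finite F \<and> F \<subseteq> insert X M \<and> S \<inter> \<Inter>F = {}"
      using \<F>I[of "insert X M"] BM X(1) by auto
    then obtain F where F: "finite F" "F \<subseteq> insert X M" "S \<inter> \<Inter>F = {}"
      by metis
    have "S \<inter> \<Inter>(F - {X}) \<inter> X = {}"
      using F(3) by blast
    moreover have "finite (F - {X})" "F - {X} \<subseteq> M"
      using F by auto
    ultimately show ?thesis
      by metis
  qed
  have dichotomy: "X \<in> M \<or> S - X \<in> M" if "X \<subseteq> S" for X
  proof (rule ccontr)
    assume *: "\<not> (X \<in> M \<or> S - X \<in> M)"
    obtain F where F: "finite F" "F \<subseteq> M" "S \<inter> \<Inter>F \<inter> X = {}"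
      using avoid[of X] * \<open>X \<subseteq> S\<close> by metis
    obtain G where G: "finite G" "G \<subseteq> M" "S \<inter> \<Inter>G \<inter> (S - X) = {}"
      using avoid[of "S - X"] * Diff_subset by metis
    \<comment> \<open>One intersection misses \<open>X\<close> and the other misses its complement,
      so together they leave no point of \<open>S\<close>.\<close>
    have "S \<inter> \<Inter>(F \<union> G) = {}"
      using F(3) G(3) by blast
    then show False
      using fipM[of "F \<union> G"] F G by simp
  qed
  have "{} \<notin> M"
    using fipM[of "{{}}"] by auto
  then have "S \<in> M"
    using dichotomy[of S] by auto
  \<comment> \<open>Both closure properties follow from the dichotomy: if the set were missing, its
    complement would be in \<open>M\<close>, and two or three members of \<open>M\<close> would have
    empty intersection.\<close>
  moreover have "Y \<in> M" if "X \<in> M" "X \<subseteq> Y" "Y \<subseteq> S" for X Y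
  proof (rule ccontr)
    assume "Y \<notin> M"
    then have "S - Y \<in> M"
      using dichotomy \<open>Y \<subseteq> S\<close> by blast
    then show False
      using fipM[of "{X, S - Y}"] that by auto
  qed
  moreover have "X \<inter> Y \<in> M" if "X \<in> M" "Y \<in> M" for X Y
  proof (rule ccontr)
    assume "X \<inter> Y \<notin> M"
    then have "S - (X \<inter> Y) \<in> M"
      using dichotomy[of "X \<inter> Y"] BM that by blast
    then show False
      using fipM[of "{X, Y, S - (X \<inter> Y)}"] that by auto
  qed
  ultimately have "M \<in> ultrafilters_on S"
    using BM(2) \<open>{} \<notin> M\<close> dichotomy unfolding ultrafilters_on_def by simp
  then show ?thesis
    using that BM(1) by simp
qed

section \<open>Compactness: reducing an equation family to finitely many sets\<close>

definition unseparated :: "nat set set \<Rightarrow> ('s \<Rightarrow> nat) list \<Rightarrow> 's \<Rightarrow> bool" where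
  "unseparated F ps x \<longleftrightarrow> (\<forall>P\<in>F. \<forall>p\<in>set ps. \<forall>q\<in>set ps. p x \<in> P \<longleftrightarrow> q x \<in> P)"

lemma unseparated_antimono: "F \<subseteq> G \<Longrightarrow> unseparated G ps x \<Longrightarrow> unseparated F ps x"
  unfolding unseparated_def by blast

text \<open>The finite, ultrafilter-free form of an equation family. Enlarging \<open>F\<close>
  leaves fewer unseparated points to check, so finite families found for different equations can be
  united.\<close>

definition refines_eq ::
  "'a set \<Rightarrow> nat \<Rightarrow> ('a marked_word \<Rightarrow> nat) list \<Rightarrow> ('a marked_word \<Rightarrow> 'a list) \<Rightarrow>
   ('a marked_word \<Rightarrow> 'a list) \<Rightarrow> 'a list set \<Rightarrow> nat set set \<Rightarrow> bool" where
  "refines_eq A n ps u v L F \<longleftrightarrow>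
    (\<forall>x\<in>tensor A n UNIV. unseparated F ps x \<longrightarrow> (u x \<in> L \<longleftrightarrow> v x \<in> L))"

lemma refines_eq_mono: "refines_eq A n ps u v L F \<Longrightarrow> F \<subseteq> G \<Longrightarrow> refines_eq A n ps u v L G"
  unfolding refines_eq_def by (metis unseparated_antimono)

text \<open>Both the condition on \<nu> and the equation are equivalences between memberships in
  \<nu>, so each becomes membership of agreement sets. Since \<open>beta_map\<close> collects only
  subsets of \<open>lists A\<close>, the hypothesis on \<open>L\<close> makes \<open>L\<close>
  eligible for membership.\<close>

lemma satisfies_eq_family_iff:
  assumes "L \<subseteq> lists A"
  shows "satisfies_family L (eq_family A n ps u v) \<longleftrightarrow>
    (\<forall>\<nu>\<in>ultrafilters_on (tensor A n UNIV).
      (\<forall>P. \<forall>p\<in>set ps. \<forall>q\<in>set ps. {x \<in> tensor A n UNIV. p x \<in> P \<longleftrightarrow> q x \<in> P} \<in> \<nu>) \<longrightarrow>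
      {x \<in> tensor A n UNIV. u x \<in> L \<longleftrightarrow> v x \<in> L} \<in> \<nu>)"
proof -
  let ?D = "tensor A n UNIV"
  have projs: "(\<forall>p\<in>set ps. \<forall>q\<in>set ps. beta_map ?D UNIV p \<nu> = beta_map ?D UNIV q \<nu>) \<longleftrightarrow>
      (\<forall>P. \<forall>p\<in>set ps. \<forall>q\<in>set ps. {x \<in> ?D. p x \<in> P \<longleftrightarrow> q x \<in> P} \<in> \<nu>)"
    if "\<nu> \<in> ultrafilters_on ?D" for \<nu>
    unfolding ultrafilter_iff_iff[OF that] beta_map_def set_eq_iff[of "Collect _"] by auto
  have eqs: "satisfies_eq L (beta_map ?D (lists A) u \<nu>, beta_map ?D (lists A) v \<nu>) \<longleftrightarrow>
      {x \<in> ?D. u x \<in> L \<longleftrightarrow> v x \<in> L} \<in> \<nu>"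
    if "\<nu> \<in> ultrafilters_on ?D" for \<nu>
    using assms unfolding ultrafilter_iff_iff[OF that] satisfies_eq_def beta_map_def by auto
  have "satisfies_family L (eq_family A n ps u v) \<longleftrightarrow>
    (\<forall>\<nu>\<in>ultrafilters_on ?D.
      (\<forall>p\<in>set ps. \<forall>q\<in>set ps. beta_map ?D UNIV p \<nu> = beta_map ?D UNIV q \<nu>) \<longrightarrow>
      satisfies_eq L (beta_map ?D (lists A) u \<nu>, beta_map ?D (lists A) v \<nu>))"
    unfolding satisfies_family_def eq_family_def Let_def by blast
  then show ?thesis
    using projs eqs by simp
qed

lemma satisfies_eq_family_iff_finite:
  assumes "L \<subseteq> lists A"
  shows "satisfies_family L (eq_family A n ps u v) \<longleftrightarrow>
    (\<exists>F. finite F \<and> refines_eq A n ps u v L F)"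
proof
  let ?D = "tensor A n UNIV"
  assume sat: "satisfies_family L (eq_family A n ps u v)"
  show "\<exists>F. finite F \<and> refines_eq A n ps u v L F"
  proof (rule ccontr)
    assume none: "\<not> ?thesis"
    define bad where "bad F = {x \<in> ?D. unseparated F ps x \<and> \<not> (u x \<in> L \<longleftrightarrow> v x \<in> L)}" for F
    have bad_ne: "bad F \<noteq> {}" if "finite F" for F
    proof -
      have "\<not> refines_eq A n ps u v L F"
        using none that by simp
      then show ?thesis
        unfolding bad_def refines_eq_def by blast
    qed
    have bad_mono: "bad G \<subseteq> bad F" if "F \<subseteq> G" for F G
      unfolding bad_def using unseparated_antimono[OF that, of ps] by blast
    have fip: "?D \<inter> \<Inter>C \<noteq> {}" if C: "finite C" "C \<subseteq> bad ` Collect finite" for C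
    proof -
      obtain \<G> where \<G>: "finite \<G>" "\<G> \<subseteq> Collect finite" "C = bad ` \<G>"
        using finite_subset_image[OF C] by metis
      \<comment> \<open>The family \<open>bad\<close> is antitone, so the counterexamples for the
        union of finitely many finite families lie in all the given sets. This also covers an empty
        \<open>C\<close>.\<close>
      have "finite (\<Union>\<G>)"
        using \<G>(1,2) by (intro finite_Union) auto
      have "bad (\<Union>\<G>) \<subseteq> bad F" if "F \<in> \<G>" for F
        using that by (intro bad_mono) blast
      then have "bad (\<Union>\<G>) \<subseteq> ?D \<inter> \<Inter>C"
        unfolding \<G>(3) by (auto simp: bad_def)
      then show ?thesis
        using bad_ne[OF \<open>finite (\<Union>\<G>)\<close>] by blast
    qed
    have "bad ` Collect finite \<subseteq> Pow ?D"
      unfolding bad_def by blast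
    then obtain \<nu> where \<nu>: "\<nu> \<in> ultrafilters_on ?D" "bad ` Collect finite \<subseteq> \<nu>"
      by (rule ultrafilter_extends_fip[OF _ fip])
    have bad_in: "bad F \<in> \<nu>" if "finite F" for F
      using \<nu>(2) that by (simp add: image_subset_iff)
    have "{x \<in> ?D. p x \<in> P \<longleftrightarrow> q x \<in> P} \<in> \<nu>" if "p \<in> set ps" "q \<in> set ps" for P p q
    proof (rule ultrafilters_onD(3)[OF \<nu>(1)])
      \<comment> \<open>The singleton family suffices: no point of \<open>bad {P}\<close> has values
        separated by \<open>P\<close>.\<close>
      show "bad {P} \<in> \<nu>"
        by (simp add: bad_in)
      have "p x \<in> P \<longleftrightarrow> q x \<in> P" if "unseparated {P} ps x" for x
        using that \<open>p \<in> set ps\<close> \<open>q \<in> set ps\<close> unfolding unseparated_def by blast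
      then show "bad {P} \<subseteq> {x \<in> ?D. p x \<in> P \<longleftrightarrow> q x \<in> P}"
        unfolding bad_def by blast
    qed simp
    then have "{x \<in> ?D. u x \<in> L \<longleftrightarrow> v x \<in> L} \<in> \<nu>"
      by (intro mp[OF bspec[OF sat[unfolded satisfies_eq_family_iff[OF assms]] \<nu>(1)]] allI ballI)
    \<comment> \<open>The empty family separates nothing, so \<open>bad {}\<close> is the whole set
      where the equation fails, the complement of the set just placed in \<nu>.\<close>
    moreover have "bad {} \<in> \<nu>"
      by (simp add: bad_in)
    moreover have "bad {} = {x \<in> ?D. \<not> (u x \<in> L \<longleftrightarrow> v x \<in> L)}"
      unfolding bad_def unseparated_def by simp
    ultimately show False
      using ultrafilter_not_iff[OF \<nu>(1), of "\<lambda>x. u x \<in> L \<longleftrightarrow> v x \<in> L"] by simp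
  qed
next
  let ?D = "tensor A n UNIV"
  assume "\<exists>F. finite F \<and> refines_eq A n ps u v L F"
  then obtain F where F: "finite F" "refines_eq A n ps u v L F"
    by blast
  show "satisfies_family L (eq_family A n ps u v)"
    unfolding satisfies_eq_family_iff[OF assms]
  proof (intro ballI impI)
    fix \<nu>
    assume \<nu>: "\<nu> \<in> ultrafilters_on ?D"
      and eq: "\<forall>P. \<forall>p\<in>set ps. \<forall>q\<in>set ps. {x \<in> ?D. p x \<in> P \<longleftrightarrow> q x \<in> P} \<in> \<nu>"
    \<comment> \<open>A finite intersection of agreement sets, because both \<open>F\<close> and
      \<open>set ps\<close> are finite.\<close>
    have "{x \<in> ?D. unseparated F ps x} \<in> \<nu>"
      unfolding unseparated_def
      by (intro ultrafilter_ball_finite[OF \<nu>] F(1) finite_set) (rule eq[rule_format])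
    then show "{x \<in> ?D. u x \<in> L \<longleftrightarrow> v x \<in> L} \<in> \<nu>"
      by (rule ultrafilters_onD(3)[OF \<nu>]) (use F(2) in \<open>auto simp: refines_eq_def\<close>)
  qed
qed

section \<open>Colourings as finite separating families\<close>

lemma refines_eq_colouring_iff:
  assumes "finite_colouring l Q" "ps \<noteq> []"
  shows "refines_eq A n ps u v L (Q ` {1..l}) \<longleftrightarrow>
    (\<Union>i\<in>{1..l}. {x \<in> tensor A n UNIV. \<forall>p\<in>set ps. p x \<in> Q i}) \<subseteq> E_set A n L u v"
proof -
  \<comment> \<open>No colour class separates the values exactly when they all have one colour:
    covering supplies a colour for one value, and disjointness rules out every other colour.\<close>
  have "unseparated (Q ` {1..l}) ps x \<longleftrightarrow> (\<exists>i\<in>{1..l}. \<forall>p\<in>set ps. p x \<in> Q i)" for x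
  proof
    assume un: "unseparated (Q ` {1..l}) ps x"
    obtain p where p: "p \<in> set ps"
      using assms(2) by (cases ps) auto
    have "p x \<in> (\<Union>i\<in>{1..l}. Q i)"
      using assms(1) unfolding finite_colouring_def by simp
    then obtain i where i: "i \<in> {1..l}" "p x \<in> Q i"
      by blast
    have "q x \<in> Q i" if "q \<in> set ps" for q
      using un p i that unfolding unseparated_def by blast
    with i(1) show "\<exists>i\<in>{1..l}. \<forall>p\<in>set ps. p x \<in> Q i"
      by blast
  next
    assume "\<exists>i\<in>{1..l}. \<forall>p\<in>set ps. p x \<in> Q i"
    then obtain i where i: "i \<in> {1..l}" "\<And>p. p \<in> set ps \<Longrightarrow> p x \<in> Q i"
      by blast
    have "p x \<in> Q k \<longleftrightarrow> k = i" if "k \<in> {1..l}" "p \<in> set ps" for k p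
      using assms(1) i(1) i(2)[OF that(2)] that(1)
      unfolding finite_colouring_def disjoint_family_on_def by blast
    then show "unseparated (Q ` {1..l}) ps x"
      unfolding unseparated_def by simp
  qed
  then show ?thesis
    unfolding refines_eq_def E_set_def by blast
qed

lemma refines_eq_colouring_transfer:
  assumes "refines_eq A n ps u v L F"
    and cell: "\<forall>i j. (\<forall>k\<in>{1..l}. i \<in> Q k \<longleftrightarrow> j \<in> Q k) \<longrightarrow> (\<forall>P\<in>F. i \<in> P \<longleftrightarrow> j \<in> P)"
  shows "refines_eq A n ps u v L (Q ` {1..l})"
proof -
  have "unseparated F ps x" if "unseparated (Q ` {1..l}) ps x" for x
    unfolding unseparated_def
  proof (intro ballI)
    fix P p q
    assume *: "P \<in> F" "p \<in> set ps" "q \<in> set ps"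
    have "\<forall>k\<in>{1..l}. p x \<in> Q k \<longleftrightarrow> q x \<in> Q k"
      using that *(2,3) unfolding unseparated_def by blast
    then show "p x \<in> P \<longleftrightarrow> q x \<in> P"
      by (rule cell[THEN spec, THEN spec, THEN mp, THEN bspec, OF _ *(1)])
  qed
  then show ?thesis
    using assms(1) unfolding refines_eq_def by blast
qed

text \<open>Colour \<open>i\<close> by its trace, the set of members of \<open>F\<close> that
  contain it. The nonempty classes are the atoms of the Boolean algebra generated by
  \<open>F\<close>, so the colour determines membership in each \<open>P\<close>.\<close>

lemma finite_colouring_generated:
  fixes F :: "nat set set"
  assumes "finite F"
  obtains l Q where "l \<ge> 1" "finite_colouring l Q"
    "\<forall>i j. (\<forall>k\<in>{1..l}. i \<in> Q k \<longleftrightarrow> j \<in> Q k) \<longrightarrow> (\<forall>P\<in>F. i \<in> P \<longleftrightarrow> j \<in> P)"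
proof -
  \<comment> \<open>All subsets of \<open>F\<close> serve as labels. Those that are no trace give
    empty classes, and \<open>l\<close> is at least 1 even for empty \<open>F\<close>.\<close>
  define l where "l = card (Pow F)"
  obtain h where h: "bij_betw h {1..l} (Pow F)"
    using assms ex_bij_betw_nat_finite_1[of "Pow F"] unfolding l_def by blast
  define Q where "Q k = {i. {P \<in> F. i \<in> P} = h k}" for k
  have surj: "\<exists>k\<in>{1..l}. {P \<in> F. i \<in> P} = h k" for i
  proof -
    have "{P \<in> F. i \<in> P} \<in> h ` {1..l}"
      unfolding bij_betw_imp_surj_on[OF h] by simp
    then show ?thesis by (simp add: image_iff)
  qed
  show ?thesis
  proof
    show "l \<ge> 1"
      using assms unfolding l_def by (simp add: card_Pow)
    have "disjoint_family_on Q {1..l}"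
      unfolding disjoint_family_on_def Q_def
      using inj_onD[OF bij_betw_imp_inj_on[OF h]] by fastforce
    moreover have "(\<Union>k\<in>{1..l}. Q k) = UNIV"
      using surj unfolding Q_def by auto
    ultimately show "finite_colouring l Q"
      unfolding finite_colouring_def by blast
    show "\<forall>i j. (\<forall>k\<in>{1..l}. i \<in> Q k \<longleftrightarrow> j \<in> Q k) \<longrightarrow> (\<forall>P\<in>F. i \<in> P \<longleftrightarrow> j \<in> P)"
    proof (intro allI impI ballI)
      fix i j P
      assume same: "\<forall>k\<in>{1..l}. i \<in> Q k \<longleftrightarrow> j \<in> Q k" and P: "P \<in> F"
      obtain k where k: "k \<in> {1..l}" "{P \<in> F. i \<in> P} = h k"
        using surj by blast
      then have "i \<in> Q k"
        unfolding Q_def by simp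
      then have "j \<in> Q k"
        using same k(1) by simp
      then have "P \<in> {P \<in> F. i \<in> P} \<longleftrightarrow> P \<in> {P \<in> F. j \<in> P}"
        unfolding k(2) Q_def by simp
      with P show "i \<in> P \<longleftrightarrow> j \<in> P"
        by simp
    qed
  qed
qed

section \<open>The three equation families and the finite alphabet\<close>

lemma tensor_2_eq:
  "tensor A 2 Q = {x \<in> tensor A 2 UNIV. \<forall>p\<in>set [proj 1, proj 2]. p x \<in> Q}"
  by (auto simp: tensor_def proj_def length_Suc_conv numeral_2_eq_2)

lemma tensor_3_eq:
  "tensor A 3 Q = {x \<in> tensor A 3 UNIV. \<forall>p\<in>set [proj 1, proj 2, proj 3]. p x \<in> Q}"
  by (auto simp: tensor_def proj_def length_Suc_conv numeral_3_eq_3 numeral_2_eq_2)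

text \<open>The word length acts as one more value to be coloured, next to the marked position, so
  this family fits the same scheme as the other two.\<close>

lemma len_tensor_eq:
  "len_tensor A Q = {x \<in> tensor A 1 UNIV. \<forall>p\<in>set [proj 1, word_len]. p x \<in> Q}"
  by (auto simp: len_tensor_def proj_def word_len_def)

theorem mainTheorem13:
  fixes A :: "'a set" and L :: "'a list set"
  assumes "finite A" and "L \<subseteq> lists A"
  shows "(\<forall>a\<in>A. \<forall>b\<in>A.
            satisfies_family L (Eq_ab_ba A a b) \<and>
            satisfies_family L (Eq_aab_abb A a b) \<and>
            satisfies_family L (Eq_a_aa A a))
     \<longleftrightarrow> (\<exists>l\<ge>1. \<exists>Q. finite_colouring l Q \<and>
          (\<forall>a\<in>A. \<forall>b\<in>A.
            (\<Union>i\<in>{1..l}. tensor A 2 (Q i))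
              \<subseteq> E_set A 2 L (subst_letters [a, b]) (subst_letters [b, a]) \<and>
            (\<Union>i\<in>{1..l}. tensor A 3 (Q i))
              \<subseteq> E_set A 3 L (subst_letters [a, a, b]) (subst_letters [a, b, b]) \<and>
            (\<Union>i\<in>{1..l}. len_tensor A (Q i))
              \<subseteq> E_set A 1 L (subst_letters [a]) (subst_append a)))"
proof -
  \<comment> \<open>Both sides of the theorem reduce to \<open>ref\<close>: the equations ask for
    some finite \<open>F\<close> for each pair of letters, the inclusions for the classes of one
    colouring common to all pairs.\<close>
  define ref where "ref a b F \<longleftrightarrow>
    refines_eq A 2 [proj 1, proj 2] (subst_letters [a, b]) (subst_letters [b, a]) L F \<and>
    refines_eq A 3 [proj 1, proj 2, proj 3] (subst_letters [a, a, b]) (subst_letters [a, b, b]) L F \<and>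
    refines_eq A 1 [proj 1, word_len] (subst_letters [a]) (subst_append a) L F" for a b F
  have ref_mono: "ref a b G" if "ref a b F" "F \<subseteq> G" for a b F G
    using that refines_eq_mono unfolding ref_def by blast
  have lhs: "satisfies_family L (Eq_ab_ba A a b) \<and> satisfies_family L (Eq_aab_abb A a b) \<and>
      satisfies_family L (Eq_a_aa A a) \<longleftrightarrow> (\<exists>F. finite F \<and> ref a b F)" (is "?l \<longleftrightarrow> ?r") for a b
  proof
    assume ?l
    then obtain F1 F2 F3 where F: "finite F1" "finite F2" "finite F3"
      "refines_eq A 2 [proj 1, proj 2] (subst_letters [a, b]) (subst_letters [b, a]) L F1"
      "refines_eq A 3 [proj 1, proj 2, proj 3] (subst_letters [a, a, b]) (subst_letters [a, b, b]) L F2"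
      "refines_eq A 1 [proj 1, word_len] (subst_letters [a]) (subst_append a) L F3"
      unfolding Eq_ab_ba_def Eq_aab_abb_def Eq_a_aa_def satisfies_eq_family_iff_finite[OF assms(2)]
      by blast
    have "ref a b (F1 \<union> F2 \<union> F3)"
      unfolding ref_def
      using F(4-6)[THEN refines_eq_mono, of "F1 \<union> F2 \<union> F3"] by blast
    then show ?r
      using F(1-3) by (intro exI[of _ "F1 \<union> F2 \<union> F3"]) simp
  next
    assume ?r
    then show ?l
      unfolding Eq_ab_ba_def Eq_aab_abb_def Eq_a_aa_def satisfies_eq_family_iff_finite[OF assms(2)]
        ref_def by blast
  qed
  have rhs: "(\<Union>i\<in>{1..l}. tensor A 2 (Q i))
              \<subseteq> E_set A 2 L (subst_letters [a, b]) (subst_letters [b, a]) \<and>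
            (\<Union>i\<in>{1..l}. tensor A 3 (Q i))
              \<subseteq> E_set A 3 L (subst_letters [a, a, b]) (subst_letters [a, b, b]) \<and>
            (\<Union>i\<in>{1..l}. len_tensor A (Q i))
              \<subseteq> E_set A 1 L (subst_letters [a]) (subst_append a) \<longleftrightarrow> ref a b (Q ` {1..l})"
    if "finite_colouring l Q" for l Q a b
    unfolding ref_def refines_eq_colouring_iff[OF that list.distinct(2)]
      tensor_2_eq[of A "Q _"] tensor_3_eq[of A "Q _"] len_tensor_eq ..
  have "(\<forall>a\<in>A. \<forall>b\<in>A. \<exists>F. finite F \<and> ref a b F) \<longleftrightarrow>
      (\<exists>l\<ge>1. \<exists>Q. finite_colouring l Q \<and> (\<forall>a\<in>A. \<forall>b\<in>A. ref a b (Q ` {1..l})))"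
  proof
    assume "\<forall>a\<in>A. \<forall>b\<in>A. \<exists>F. finite F \<and> ref a b F"
    then obtain F where F: "\<And>a b. a \<in> A \<Longrightarrow> b \<in> A \<Longrightarrow> finite (F a b) \<and> ref a b (F a b)"
      by metis
    \<comment> \<open>Finiteness of the alphabet enters here: the union over all pairs of letters is
      still finite, so a single colouring handles every pair.\<close>
    define G where "G = (\<Union>a\<in>A. \<Union>b\<in>A. F a b)"
    have "finite G"
      unfolding G_def using assms(1) F by blast
    have G: "ref a b G" if "a \<in> A" "b \<in> A" for a b
      by (rule ref_mono[of a b "F a b"]) (use F that in \<open>auto simp: G_def\<close>)
    obtain l Q where lQ: "l \<ge> 1" "finite_colouring l Q"
      "\<forall>i j. (\<forall>k\<in>{1..l}. i \<in> Q k \<longleftrightarrow> j \<in> Q k) \<longrightarrow> (\<forall>P\<in>G. i \<in> P \<longleftrightarrow> j \<in> P)"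
      by (rule finite_colouring_generated[OF \<open>finite G\<close>])
    have "ref a b (Q ` {1..l})" if "a \<in> A" "b \<in> A" for a b
      using G[OF that] unfolding ref_def
      by (elim conjE, intro conjI; elim refines_eq_colouring_transfer[OF _ lQ(3)])
    then show "\<exists>l\<ge>1. \<exists>Q. finite_colouring l Q \<and> (\<forall>a\<in>A. \<forall>b\<in>A. ref a b (Q ` {1..l}))"
      using lQ(1,2) by blast
  next
    assume "\<exists>l\<ge>1. \<exists>Q. finite_colouring l Q \<and> (\<forall>a\<in>A. \<forall>b\<in>A. ref a b (Q ` {1..l}))"
    \<comment> \<open>The classes of the colouring are themselves a finite family, the same one for
      every pair.\<close>
    then show "\<forall>a\<in>A. \<forall>b\<in>A. \<exists>F. finite F \<and> ref a b F"
      by (meson finite_imageI finite_atLeastAtMost)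
  qed
  then show ?thesis
    unfolding lhs by (simp only: rhs cong: conj_cong)
qed

end
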